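(* The randomized algorithm MIX-R for buffer management with bounded delay is $\frac{e}{e-1}$-competitive against an adaptive adversary: for every adaptively created instance $I$ and every answering entity $\mathrm{ADV}$, $$\mathbb{E}[\mathcal{G}_{\text{MIX-R}}(I)]\ \ge\ \Bigl(1-\frac1e\Bigr)\cdot\mathbb{E}[\mathcal{G}_{\mathrm{ADV}}(I)].$$
   Context: **Problem (buffer management with bounded delay).** Time is divided into unit steps; step $t$ corresponds to the interval $(t,t+1)$. A packet is $(w,d)$ with weight $w>0$ and relative deadline $d$ (a positive integer at injection), the number of steps after which it expires; distinct packets may have equal weight and deadline. Buffers are initially empty. Before each step any finite set of packets may be injected, into both the algorithm's and $\mathrm{ADV}$'s buffers. In step $t$ the algorithm and $\mathrm{ADV}$ independently each choose and transmit at most one packet from their own buffer; a transmitted packet is removed from the buffer of the party that transmitted it. At time $t+1$ the relative deadlines of all remaining packets are decremented by $1$, packets whose relative deadline reaches $0$ expire and are removed from both buffers, and then the adversary injects any finite set of packets and step $t+1$ begins. A packet is pending for a party if it has been released and has neither expired nor been transmitted by that party. The gain $\mathcal{G}_X(I)$ of $X$ on instance $I$ (the sequence of injected packets) is the total weight of packets transmitted by $X$. **Adaptive(-online) adversary.** The packets injected at a given time may depend on the algorithm's (random) behavior up to that time. The adversary also provides an answering entity $\mathrm{ADV}$ that creates its own solution in parallel with the algorithm and cannot change it afterwards: its transmission in step $t$ is chosen without knowledge of the algorithm's random choice in step $t$ or later. $\mathrm{ADV}$ is deterministic (without loss of generality), but since the algorithm is randomized, so is $I$. An algorithm $\mathrm{ALG}$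 is $R$-competitive against an adaptive adversary if for any adaptively created instance $I$ and any answering entity $\mathrm{ADV}$, $\mathbb{E}[\mathcal{G}_{\mathrm{ALG}}(I)]\ge \frac1R\,\mathbb{E}[\mathcal{G}_{\mathrm{ADV}}(I)]$ (no additive constant). **Dominance.** A pending packet $a=(w_a,d_a)$ is dominated by a pending packet $b=(w_b,d_b)$ if $w_a\le w_b$ and $d_a\ge d_b$; it is strictly dominated by $b$ if moreover one of these inequalities is strict. A packet is (strictly) dominated if some pending packet (strictly) dominates it. **Algorithm MIX-R (one step).** If there are no pending packets, do nothing. Otherwise set $m\leftarrow 0$, $n\leftarrow 0$, $r\leftarrow 1$, $H_0\leftarrow$ the set of packets pending for the algorithm, and $h_0=(w_0,d_0)\leftarrow$ a heaviest packet of $H_0$. While $H_m\neq\emptyset$, do: 1. $m\leftarrow m+1$; 2. $h_m=(w_m,d_m)\leftarrow$ a heaviest not strictly dominated packet from $H_{m-1}$; 3. $p_{m-1}\leftarrow\min\{1-\frac{w_m}{w_{m-1}},\,r\}$; 4. $r\leftarrow r-p_{m-1}$; 5. if $r>0$ then $n\leftarrow n+1$; 6. $H_m\leftarrow\{x\in H_{m-1} : x\text{ is not dominated by }h_m\}$. After the loop set $p_m\leftarrow r$. Transmit a packet chosen (with fresh randomness) from $h_1,\dots,h_n$ with probability distribution $p_1,\dots,p_n$. (Always $p_0=0$.) *)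

theory Defs
  imports "HOL-Probability.Probability"
begin

section \<open>Packets and buffers\<close>

text \<open>
  A packet is a pair of its weight and its (current) relative deadline.  Distinct packets may
  agree in both components, so buffers and injections are multisets; being multisets they are
  finite.  Two copies of the same pair are interchangeable.
\<close>

type_synonym packet = "real \<times> nat"
type_synonym buffer = "packet multiset"

abbreviation weight :: "packet \<Rightarrow> real" where "weight \<equiv> fst"
abbreviation deadline :: "packet \<Rightarrow> nat" where "deadline \<equiv> snd"

definition legal_packets :: "buffer \<Rightarrow> bool" where
  "legal_packets B \<longleftrightarrow> (\<forall>p \<in># B. 0 < weight p \<and> 0 < deadline p)"

definition send :: "packet option \<Rightarrow> buffer \<Rightarrow> buffer" where
  "send x B = (case x of None \<Rightarrow> B | Some p \<Rightarrow> B - {#p#})"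

definition age :: "buffer \<Rightarrow> buffer" where
  "age B = filter_mset (\<lambda>p. 0 < deadline p) (image_mset (\<lambda>(w, d). (w, d - 1)) B)"

text \<open>
  The packets pending at the beginning of step \<open>t\<close> for a party that transmits \<open>s t\<close> in step
  \<open>t\<close>, where \<open>J t\<close> is injected at time \<open>t\<close>.
\<close>

primrec pending :: "(nat \<Rightarrow> buffer) \<Rightarrow> (nat \<Rightarrow> packet option) \<Rightarrow> nat \<Rightarrow> buffer" where
  "pending J s 0 = J 0"
| "pending J s (Suc t) = age (send (s t) (pending J s t)) + J (Suc t)"

definition gain :: "(nat \<Rightarrow> packet option) \<Rightarrow> ennreal" where
  "gain s = (\<Sum>t. case s t of None \<Rightarrow> 0 | Some p \<Rightarrow> ennreal (weight p))"


section \<open>The game against an adaptive adversary\<close>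

text \<open>
  A run is the sequence \<open>\<omega>\<close> of the algorithm's transmissions.  The adversary is a pair of
  functions of the algorithm's transmissions in the steps before \<open>t\<close>: the packets \<open>release\<close>
  injected at time \<open>t\<close> and the packet \<open>adv\<close> transmitted by the answering entity in step \<open>t\<close>.
  Since the adversary is deterministic, its own past is determined by the same list.
\<close>

definition hist :: "(nat \<Rightarrow> packet option) \<Rightarrow> nat \<Rightarrow> packet option list" where
  "hist \<omega> t = map \<omega> [0..<t]"

type_synonym injector = "packet option list \<Rightarrow> buffer"
type_synonym answerer = "packet option list \<Rightarrow> packet option"

definition instance_of :: "injector \<Rightarrow> (nat \<Rightarrow> packet option) \<Rightarrow> nat \<Rightarrow> buffer" where
  "instance_of release \<omega> t = release (hist \<omega> t)"

definition answers_of :: "answerer \<Rightarrow> (nat \<Rightarrow> packet option) \<Rightarrow> nat \<Rightarrow> packet option" where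
  "answers_of adv \<omega> t = adv (hist \<omega> t)"

definition adversary :: "injector \<Rightarrow> answerer \<Rightarrow> bool" where
  "adversary release adv \<longleftrightarrow>
     (\<forall>h. legal_packets (release h)) \<and>
     (\<forall>\<omega> t p. answers_of adv \<omega> t = Some p \<longrightarrow>
        p \<in># pending (instance_of release \<omega>) (answers_of adv \<omega>) t)"

text \<open>
  A randomized algorithm without memory: a distribution on what to transmit, depending on the
  pending packets only.
\<close>

type_synonym algorithm = "buffer \<Rightarrow> packet option pmf"

definition transmits_pending :: "algorithm \<Rightarrow> bool" where
  "transmits_pending alg \<longleftrightarrow>
     (\<forall>B. legal_packets B \<longrightarrow> set_pmf (alg B) \<subseteq> insert None (Some ` set_mset B))"

text \<open>
  \<open>M\<close> is the law of the run of \<open>alg\<close> on the instance created by \<open>release\<close>: given the past up to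
  step \<open>t\<close>, the transmission in step \<open>t\<close> is distributed as \<open>alg\<close> prescribes for its current
  buffer.  This determines \<open>M\<close> on all events that depend on finitely many steps.  Measurability
  is required of whole histories, because \<open>release\<close> and \<open>adv\<close> are arbitrary functions of them and
  the type of packets is uncountable.
\<close>

definition run_law :: "algorithm \<Rightarrow> injector \<Rightarrow> (nat \<Rightarrow> packet option) measure \<Rightarrow> bool" where
  "run_law alg release M \<longleftrightarrow>
     prob_space M \<and> space M = UNIV \<and>
     (\<forall>t. (\<lambda>\<omega>. hist \<omega> t) \<in> measurable M (count_space UNIV)) \<and>
     (\<forall>\<omega> t. measure M {\<omega>'. hist \<omega>' (Suc t) = hist \<omega> (Suc t)} =
        measure M {\<omega>'. hist \<omega>' t = hist \<omega> t} *
        pmf (alg (pending (instance_of release \<omega>) \<omega> t)) (\<omega> t))"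

text \<open>Such a law exists for every algorithm and every injector.\<close>

lemma pending_cong:
  "(\<And>i. i \<le> t \<Longrightarrow> J i = J' i) \<Longrightarrow> (\<And>i. i < t \<Longrightarrow> s i = s' i) \<Longrightarrow> pending J s t = pending J' s' t"
  by (induction t) auto

lemma take_hist: "i \<le> t \<Longrightarrow> take i (hist \<omega> t) = hist \<omega> i"
  by (auto simp: hist_def take_map)

lemma run_law_exists: "\<exists>M. run_law alg release M"
proof -
  define q where "q h = alg (pending (\<lambda>i. release (take i h)) (\<lambda>i. h ! i) (length h))" for h
  have q_hist: "q (hist \<omega> t) = alg (pending (instance_of release \<omega>) \<omega> t)" for \<omega> t
  proof -
    have "pending (\<lambda>i. release (take i (hist \<omega> t))) (\<lambda>i. hist \<omega> t ! i) t
        = pending (instance_of release \<omega>) \<omega> t"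
      by (rule pending_cong) (auto simp: instance_of_def take_hist, simp add: hist_def)
    then show ?thesis by (simp add: q_def hist_def)
  qed
  define K where "K h = restrict_space (measure_pmf (q h)) (set_pmf (q h))" for h
  have K_space: "space (K h) = set_pmf (q h)" for h by (simp add: K_def space_restrict_space)
  have K_sets: "sets (K h) = Pow (set_pmf (q h))" for h
    by (auto simp: K_def sets_restrict_space)
  have K_prob: "prob_space (K h)" for h
    unfolding K_def by (rule prob_space_restrict_space) (auto simp: measure_pmf.emeasure_eq_1_AE AE_measure_pmf)
  interpret K: prob_space "K h" for h by (rule K_prob)
  interpret product_prob_space K UNIV by unfold_locales
  define N where "N = PiM UNIV K"
  interpret N: prob_space N unfolding N_def by (rule prob_space_PiM) (rule K_prob)
  define hs where "hs X = rec_nat [] (\<lambda>_ h. h @ [X h])" for X :: "packet option list \<Rightarrow> packet option"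
  have hs_simps: "hs X 0 = []" "hs X (Suc t) = hs X t @ [X (hs X t)]" for X t
    by (simp_all add: hs_def)
  have len: "length (hs X t) = t" for X t by (induction t) (auto simp: hs_simps)
  define path where "path X t = X (hs X t)" for X t
  have hist_path: "hist (path X) t = hs X t" for X t
    by (induction t) (auto simp: hist_def path_def hs_simps)
  define R where "R = rec_nat {[]} (\<lambda>_ S. \<Union>h\<in>S. (\<lambda>x. h @ [x]) ` set_pmf (q h))"
  have R_simps: "R 0 = {[]}" "R (Suc t) = (\<Union>h\<in>R t. (\<lambda>x. h @ [x]) ` set_pmf (q h))" for t
    by (simp_all add: R_def)
  have R_count: "countable (R t)" for t by (induction t) (auto simp: R_simps)
  have hs_meas: "(\<lambda>X. hs X t) \<in> measurable N (count_space (R t))" for t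
  proof (induction t)
    case (Suc t)
    show ?case unfolding hs_simps
    proof (rule measurable_compose_countable'[OF _ Suc R_count])
      fix h assume h: "h \<in> R t"
      have 1: "(\<lambda>X. X h) \<in> measurable N (K h)" unfolding N_def by measurable
      have 2: "(\<lambda>x. h @ [x]) \<in> measurable (K h) (count_space (R (Suc t)))"
        using h by (auto simp: measurable_def K_space K_sets R_simps)
      show "(\<lambda>X. h @ [X h]) \<in> measurable N (count_space (R (Suc t)))"
        by (rule measurable_compose[OF 1 2])
    qed
  qed (simp add: hs_simps R_simps)
  have hs_meas': "(\<lambda>X. hs X t) \<in> measurable N (count_space UNIV)" for t
    by (rule measurable_compose[OF hs_meas]) simp
  define G where "G = {{\<omega>. hist \<omega> t \<in> S} | t S. True}"
  define M where "M = distr N (sigma UNIV G) path"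
  have path_meas: "path \<in> measurable N (sigma UNIV G)"
  proof (rule measurable_measure_of)
    fix A assume "A \<in> G"
    then obtain t S where A: "A = {\<omega>. hist \<omega> t \<in> S}" by (auto simp: G_def)
    have "path -` A \<inter> space N = (\<lambda>X. hs X t) -` S \<inter> space N" by (auto simp: A hist_path)
    then show "path -` A \<inter> space N \<in> sets N" using measurable_sets[OF hs_meas', of S] by simp
  qed auto
  have sM: "space M = UNIV" by (simp add: M_def space_measure_of_conv)
  have G_sets: "A \<in> G \<Longrightarrow> A \<in> sets M" for A by (simp add: M_def)
  have hm: "(\<lambda>\<omega>. hist \<omega> t) \<in> measurable M (count_space UNIV)" for t
  proof (rule measurableI)
    fix S :: "packet option list set"
    have "{\<omega>. hist \<omega> t \<in> S} \<in> G" by (auto simp: G_def)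
    moreover have "(\<lambda>\<omega>. hist \<omega> t) -` S \<inter> space M = {\<omega>. hist \<omega> t \<in> S}" by (auto simp: sM)
    ultimately show "(\<lambda>\<omega>. hist \<omega> t) -` S \<inter> space M \<in> sets M" using G_sets by simp
  qed simp
  have prefix: "measure M {\<omega>'. hist \<omega>' t = hist \<omega> t} = (\<Prod>i<t. pmf (q (hist \<omega> i)) (\<omega> i))" for \<omega> t
  proof -
    let ?J = "hist \<omega> ` {..<t}"
    let ?A = "\<lambda>h. {\<omega> (length h)} \<inter> set_pmf (q h)"
    have inj: "inj_on (hist \<omega>) {..<t}" by (auto simp: inj_on_def hist_def dest: arg_cong[of _ _ length])
    have eq: "hs X t = hist \<omega> t \<longleftrightarrow> (\<forall>h\<in>?J. X h \<in> ?A h)" if "X \<in> space N" for X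
    proof -
      have X: "X h \<in> set_pmf (q h)" for h using that by (auto simp: N_def space_PiM K_space PiE_def)
      have "hs X t = hist \<omega> t \<longleftrightarrow> (\<forall>i<t. X (hist \<omega> i) = \<omega> i)"
        by (induction t) (auto simp: hs_simps hist_def less_Suc_eq)
      then show ?thesis using X by (auto simp: hist_def)
    qed
    have "{\<omega>'. hist \<omega>' t = hist \<omega> t} = (\<lambda>\<omega>'. hist \<omega>' t) -` {hist \<omega> t} \<inter> space M" by (auto simp: sM)
    then have "{\<omega>'. hist \<omega>' t = hist \<omega> t} \<in> sets M" using measurable_sets[OF hm] by simp
    then have "measure M {\<omega>'. hist \<omega>' t = hist \<omega> t}
        = measure N (path -` {\<omega>'. hist \<omega>' t = hist \<omega> t} \<inter> space N)"
      unfolding M_def by (intro measure_distr path_meas) (simp add: M_def)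
    also have "path -` {\<omega>'. hist \<omega>' t = hist \<omega> t} \<inter> space N = {X\<in>space N. \<forall>h\<in>?J. X h \<in> ?A h}"
      using eq by (auto simp: hist_path)
    also have "measure N \<dots> = (\<Prod>h\<in>?J. measure (K h) (?A h))"
    proof -
      have "emeasure N {X\<in>space N. \<forall>h\<in>?J. X h \<in> ?A h} = (\<Prod>h\<in>?J. emeasure (K h) (?A h))"
        unfolding N_def by (rule emeasure_PiM_Collect) (auto simp: K_sets)
      then show ?thesis
        by (simp add: N.emeasure_eq_measure K.emeasure_eq_measure prod_ennreal prod_nonneg)
    qed
    also have "\<dots> = (\<Prod>i<t. measure (K (hist \<omega> i)) (?A (hist \<omega> i)))"
      using inj by (simp add: prod.reindex)
    also have "\<dots> = (\<Prod>i<t. pmf (q (hist \<omega> i)) (\<omega> i))"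
    proof (rule prod.cong[OF refl])
      fix i
      have "measure (K (hist \<omega> i)) (?A (hist \<omega> i)) = measure (measure_pmf (q (hist \<omega> i))) (?A (hist \<omega> i))"
        unfolding K_def by (rule measure_restrict_space) auto
      also have "\<dots> = pmf (q (hist \<omega> i)) (\<omega> i)"
        by (cases "\<omega> i \<in> set_pmf (q (hist \<omega> i))") (auto simp: measure_pmf_single hist_def set_pmf_iff)
      finally show "measure (K (hist \<omega> i)) (?A (hist \<omega> i)) = pmf (q (hist \<omega> i)) (\<omega> i)" .
    qed
    finally show ?thesis .
  qed
  have "run_law alg release M"
    unfolding run_law_def
  proof (intro conjI allI)
    show "prob_space M" unfolding M_def by (rule N.prob_space_distr[OF path_meas])
    show "space M = UNIV" by (rule sM)
    show "(\<lambda>\<omega>. hist \<omega> t) \<in> measurable M (count_space UNIV)" for t by (rule hm)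
    show "measure M {\<omega>'. hist \<omega>' (Suc t) = hist \<omega> (Suc t)} = measure M {\<omega>'. hist \<omega>' t = hist \<omega> t} *
        pmf (alg (pending (instance_of release \<omega>) \<omega> t)) (\<omega> t)" for \<omega> t
      by (simp only: prefix q_hist) simp
  qed
  then show ?thesis by blast
qed

definition competitive :: "real \<Rightarrow> algorithm \<Rightarrow> bool" where
  "competitive R alg \<longleftrightarrow>
     transmits_pending alg \<and>
     (\<forall>release adv M. adversary release adv \<longrightarrow> run_law alg release M \<longrightarrow>
        (\<integral>\<^sup>+\<omega>. gain \<omega> \<partial>M) \<ge> ennreal (1 / R) * (\<integral>\<^sup>+\<omega>. gain (answers_of adv \<omega>) \<partial>M))"


section \<open>The algorithm MIX-R\<close>

definition dominated_by :: "packet \<Rightarrow> packet \<Rightarrow> bool" where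
  "dominated_by a b \<longleftrightarrow> weight a \<le> weight b \<and> deadline a \<ge> deadline b"

definition strictly_dominated_by :: "packet \<Rightarrow> packet \<Rightarrow> bool" where
  "strictly_dominated_by a b \<longleftrightarrow>
     dominated_by a b \<and> (weight a < weight b \<or> deadline a > deadline b)"

text \<open>
  In the following \<open>P\<close> is the set of pending packets.  Copies of the same pair dominate each
  other, hence at most one of them is ever selected and it suffices to work with the set
  underlying the buffer.

  \<open>mix_next P H\<close> is a heaviest packet of \<open>H\<close> that no pending packet strictly
  dominates; it is unique, because two different pairs of equal weight have different deadlines,
  so that one strictly dominates the other.
\<close>

definition mix_next :: "packet set \<Rightarrow> packet set \<Rightarrow> packet" where
  "mix_next P H = arg_max_on weight {x \<in> H. \<not> (\<exists>y\<in>P. strictly_dominated_by x y)}"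

primrec mix_H :: "packet set \<Rightarrow> nat \<Rightarrow> packet set" where
  "mix_H P 0 = P"
| "mix_H P (Suc m) = {x \<in> mix_H P m. \<not> dominated_by x (mix_next P (mix_H P m))}"

text \<open>
  Ties may occur for \<open>mix_h P 0\<close>, but only its weight matters.
\<close>

definition mix_h :: "packet set \<Rightarrow> nat \<Rightarrow> packet" where
  "mix_h P m = (case m of 0 \<Rightarrow> arg_max_on weight P | Suc k \<Rightarrow> mix_next P (mix_H P k))"

text \<open>The number of iterations of the loop.\<close>

definition mix_m :: "packet set \<Rightarrow> nat" where
  "mix_m P = (LEAST m. mix_H P m = {})"

text \<open>\<open>mix_r P k\<close> is the value of \<open>r\<close> after \<open>k\<close> iterations.\<close>

primrec mix_r :: "packet set \<Rightarrow> nat \<Rightarrow> real" where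
  "mix_r P 0 = 1"
| "mix_r P (Suc k) =
     mix_r P k - min (1 - weight (mix_h P (Suc k)) / weight (mix_h P k)) (mix_r P k)"

definition mix_p :: "packet set \<Rightarrow> nat \<Rightarrow> real" where
  "mix_p P k =
     (if k < mix_m P
      then min (1 - weight (mix_h P (Suc k)) / weight (mix_h P k)) (mix_r P k)
      else mix_r P k)"

definition mix_n :: "packet set \<Rightarrow> nat" where
  "mix_n P = card {k \<in> {1..mix_m P}. mix_r P k > 0}"

definition MIX_R :: algorithm where
  "MIX_R B =
     (if B = {#} then return_pmf None
      else let P = set_mset B in
        pmf_of_list (map (\<lambda>i. (Some (mix_h P i), mix_p P i)) [1..<Suc (mix_n P)]))"

text \<open>
  The list defining \<open>MIX_R\<close> is a probability distribution, and only pending packets are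
  transmitted.
\<close>

lemma arg_max_weight:
  assumes "finite S" "S \<noteq> {}"
  shows "arg_max_on weight S \<in> S" "y \<in> S \<Longrightarrow> weight y \<le> weight (arg_max_on weight S)"
proof -
  have "Max (weight ` S) \<in> weight ` S" using assms by (intro Max_in) auto
  then obtain x where x: "x \<in> S" "weight x = Max (weight ` S)" by auto
  have "is_arg_max weight (\<lambda>x. x \<in> S) x"
    unfolding is_arg_max_def not_ex de_Morgan_conj not_less x(2) using assms x(1) by auto
  then have "is_arg_max weight (\<lambda>x. x \<in> S) (arg_max_on weight S)"
    unfolding arg_max_on_def arg_max_def by (rule someI)
  then have "arg_max_on weight S \<in> S \<and> (\<forall>y\<in>S. weight y \<le> weight (arg_max_on weight S))"
    unfolding is_arg_max_def Ball_def not_less[symmetric] by blast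
  then show "arg_max_on weight S \<in> S" "y \<in> S \<Longrightarrow> weight y \<le> weight (arg_max_on weight S)"
    by simp_all
qed

lemma mix_H_closed:
  "x \<in> mix_H P m \<Longrightarrow> y \<in> P \<Longrightarrow> strictly_dominated_by x y \<Longrightarrow> y \<in> mix_H P m"
  by (induction m) (auto simp: strictly_dominated_by_def dominated_by_def)

lemma mix_H_subset: "mix_H P m \<subseteq> P"
  by (induction m) auto

lemma mix_next_heaviest:
  assumes "finite P" "mix_H P m \<noteq> {}"
  shows "mix_next P (mix_H P m) \<in> mix_H P m"
    and "y \<in> mix_H P m \<Longrightarrow> weight y \<le> weight (mix_next P (mix_H P m))"
proof -
  let ?H = "mix_H P m" and ?C = "{x \<in> mix_H P m. \<not> (\<exists>y\<in>P. strictly_dominated_by x y)}"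
  have fin: "finite ?H" using mix_H_subset assms(1) by (rule finite_subset)
  define w where "w = weight (arg_max_on weight ?H)"
  let ?D = "{x \<in> ?H. weight x = w}"
  have "arg_max_on weight ?H \<in> ?D" using arg_max_weight(1)[OF fin assms(2)] by (simp add: w_def)
  then have D: "finite ?D" "?D \<noteq> {}" using fin by (simp, blast)
  obtain x where x: "x \<in> ?D" "\<And>y. y \<in> ?D \<Longrightarrow> deadline x \<le> deadline y"
    using arg_min_if_finite(1)[OF D, of deadline] arg_min_least[OF D, of _ deadline] by (rule that)
  have xC: "x \<in> ?C"
  proof -
    have False if "y \<in> P" "strictly_dominated_by x y" for y
    proof -
      have yH: "y \<in> ?H" using mix_H_closed[of x P m y] x that by auto
      then have "weight y \<le> w" using arg_max_weight(2)[OF fin assms(2)] by (simp add: w_def)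
      then show False using x(1) x(2)[of y] yH that(2)
        by (auto simp: strictly_dominated_by_def dominated_by_def)
    qed
    then show ?thesis using x by auto
  qed
  have fC: "finite ?C" "?C \<noteq> {}" using fin xC by (simp, blast)
  show "mix_next P ?H \<in> ?H" unfolding mix_next_def using arg_max_weight(1)[OF fC] by auto
  assume "y \<in> ?H"
  then have "weight y \<le> w" using arg_max_weight(2)[OF fin assms(2)] by (simp add: w_def)
  also have "w = weight x" using x by simp
  also have "\<dots> \<le> weight (mix_next P ?H)" unfolding mix_next_def by (rule arg_max_weight(2)[OF fC xC])
  finally show "weight y \<le> weight (mix_next P ?H)" .
qed

lemma mix_H_terminates:
  assumes "finite P"
  shows "\<exists>m. mix_H P m = {}"
proof (rule ccontr)
  assume ne: "\<nexists>m. mix_H P m = {}"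
  have fin: "finite (mix_H P m)" for m using mix_H_subset assms by (rule finite_subset)
  have "card (mix_H P (Suc m)) < card (mix_H P m)" for m
  proof (rule psubset_card_mono[OF fin])
    show "mix_H P (Suc m) \<subset> mix_H P m"
      using mix_next_heaviest(1)[OF assms, of m] ne by (auto simp: dominated_by_def)
  qed
  note less = this
  have "card (mix_H P m) + m \<le> card (mix_H P 0)" for m
  proof (induction m)
    case (Suc m)
    have "card (mix_H P (Suc m)) < card (mix_H P m)" by (rule less)
    then show ?case using Suc by linarith
  qed simp
  from this[of "Suc (card (mix_H P 0))"] show False by simp
qed

lemma mix_wf:
  assumes "finite P" "P \<noteq> {}" and pos: "\<And>p. p \<in> P \<Longrightarrow> 0 < weight p"
  shows "pmf_of_list_wf (map (\<lambda>i. (Some (mix_h P i), mix_p P i)) [1..<Suc (mix_n P)])"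
    and "i \<in> {1..mix_n P} \<Longrightarrow> mix_h P i \<in> P"
    and "mix_p P 0 = 0"
proof -
  let ?M = "mix_m P"
  have ne: "mix_H P k \<noteq> {}" if "k < ?M" for k
    using that not_less_Least unfolding mix_m_def by blast
  have M0: "0 < ?M"
    using LeastI_ex[OF mix_H_terminates[OF assms(1)]] assms(2) unfolding mix_m_def[symmetric]
    by (metis mix_H.simps(1) gr0I)
  have hS: "mix_h P (Suc k) \<in> mix_H P k" "y \<in> mix_H P k \<Longrightarrow> weight y \<le> weight (mix_h P (Suc k))"
    if "k < ?M" for k y
    using mix_next_heaviest[OF assms(1) ne[OF that]] by (auto simp: mix_h_def)
  have hP: "mix_h P k \<in> P" if "k \<le> ?M" for k
  proof (cases k)
    case 0 then show ?thesis using arg_max_weight(1)[OF assms(1,2)] by (simp add: mix_h_def)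
  next
    case (Suc j) then show ?thesis using hS(1)[of j] mix_H_subset[of P j] that by auto
  qed
  have anti: "weight (mix_h P (Suc k)) \<le> weight (mix_h P k)" if "k < ?M" for k
  proof (cases k)
    case 0 then show ?thesis
      using arg_max_weight(2)[OF assms(1,2)] hP[of "Suc k"] that by (simp add: mix_h_def)
  next
    case (Suc j)
    have "mix_h P (Suc k) \<in> mix_H P j" using hS(1)[OF that] Suc by auto
    then show ?thesis using hS(2)[of j] Suc that by auto
  qed
  have frac: "0 \<le> 1 - weight (mix_h P (Suc k)) / weight (mix_h P k)" if "k < ?M" for k
    using anti[OF that] pos[OF hP[of k]] that by (simp add: divide_le_eq)
  have r: "0 \<le> mix_r P k" if "k \<le> ?M" for k using that by (induction k) auto
  have rdec: "mix_r P (Suc k) \<le> mix_r P k" if "k < ?M" for k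
    using frac[OF that] r[of k] that by auto
  have rmono: "mix_r P j \<le> mix_r P i" if "i \<le> j" "j \<le> ?M" for i j
    using that by (induction j rule: dec_induct) (auto intro: order_trans[OF rdec] simp del: mix_r.simps(2))
  have p0: "0 \<le> mix_p P k" if "k \<le> ?M" for k
    using frac[of k] r[OF that] that by (auto simp: mix_p_def)
  have rp: "mix_r P (Suc k) = mix_r P k - mix_p P k" if "k < ?M" for k
    using that by (simp add: mix_p_def)
  have sum: "(\<Sum>i<k. mix_p P i) = 1 - mix_r P k" if "k \<le> ?M" for k
    using that by (induction k) (auto simp: rp simp del: mix_r.simps(2))
  have sumM: "(\<Sum>i\<le>?M. mix_p P i) = 1"
    using sum[of ?M] by (simp add: lessThan_Suc_atMost[symmetric] mix_p_def)
  have "mix_p P 0 = min (1 - weight (mix_h P (Suc 0)) / weight (mix_h P 0)) 1"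
    using M0 by (simp add: mix_p_def)
  moreover have "weight (mix_h P 0) \<le> weight (mix_h P (Suc 0))"
    using hS(2)[OF M0, of "mix_h P 0"] hP[of 0] by simp
  with anti[OF M0] have "weight (mix_h P (Suc 0)) = weight (mix_h P 0)" by simp
  moreover have "weight (mix_h P 0) \<noteq> 0" using pos[OF hP[of 0]] by simp
  ultimately show p00: "mix_p P 0 = 0" by simp
  let ?A = "{k \<in> {1..?M}. mix_r P k > 0}"
  have "\<exists>n\<le>?M. ?A = {1..n}"
  proof (cases "?A = {}")
    case True then show ?thesis by (intro exI[of _ 0]) auto
  next
    case False
    have "Max ?A \<in> ?A" using False by (intro Max_in) auto
    moreover have "?A = {1..Max ?A}"
    proof (intro equalityI subsetI)
      fix x assume "x \<in> {1..Max ?A}"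
      then show "x \<in> ?A" using \<open>Max ?A \<in> ?A\<close> rmono[of x "Max ?A"] by auto
    qed auto
    ultimately show ?thesis by (intro exI[of _ "Max ?A"] conjI) simp_all
  qed
  then obtain n where n: "n \<le> ?M" "?A = {1..n}" by blast
  have nn: "mix_n P = n" unfolding mix_n_def n by simp
  have zero: "mix_p P i = 0" if "i \<in> {..?M} - {1..n}" for i
  proof (cases i)
    case 0 then show ?thesis using p00 by simp
  next
    case (Suc j)
    then have "i \<notin> ?A" "i \<le> ?M" "1 \<le> i" using that n by auto
    then have "mix_r P i = 0" using r[of i] by (auto simp: not_less)
    then show ?thesis using frac[of i] \<open>i \<le> ?M\<close> by (auto simp: mix_p_def)
  qed
  have "(\<Sum>i\<in>{1..n}. mix_p P i) = (\<Sum>i\<le>?M. mix_p P i)"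
    using n zero by (intro sum.mono_neutral_left) auto
  then have "(\<Sum>i\<in>{1..n}. mix_p P i) = 1" using sumM by simp
  moreover have "sum_list (map (mix_p P) [1..<Suc n]) = (\<Sum>i\<in>{1..n}. mix_p P i)"
    by (simp only: interv_sum_list_conv_sum_set_nat set_upt atLeastLessThanSuc_atLeastAtMost)
  ultimately show "pmf_of_list_wf (map (\<lambda>i. (Some (mix_h P i), mix_p P i)) [1..<Suc (mix_n P)])"
    using n p0 by (auto simp: pmf_of_list_wf_def nn comp_def simp del: upt_Suc)
  show "i \<in> {1..mix_n P} \<Longrightarrow> mix_h P i \<in> P" using hP n nn by auto
qed

lemma MIX_R_transmits_pending: "transmits_pending MIX_R"
  unfolding transmits_pending_def
proof (intro allI impI)
  fix B assume B: "legal_packets B"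
  show "set_pmf (MIX_R B) \<subseteq> insert None (Some ` set_mset B)"
  proof (cases "B = {#}")
    case False
    define P where "P = set_mset B"
    define xs where "xs = map (\<lambda>i. (Some (mix_h P i), mix_p P i)) [1..<Suc (mix_n P)]"
    have fin: "finite P" and ne: "P \<noteq> {}" using False by (simp_all add: P_def)
    have pos: "0 < weight p" if "p \<in> P" for p
      using B that unfolding legal_packets_def P_def by blast
    have wf: "pmf_of_list_wf xs" unfolding xs_def by (rule mix_wf(1)) (fact fin ne pos)+
    have mem: "mix_h P i \<in> P" if "i \<in> {1..mix_n P}" for i
      by (rule mix_wf(2)[OF _ _ _ that]) (fact fin ne pos)+
    have "MIX_R B = pmf_of_list xs"
      unfolding MIX_R_def Let_def xs_def P_def using False by (simp only: if_False)
    then have "set_pmf (MIX_R B) \<subseteq> set (map fst xs)"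
      using set_pmf_of_list[OF wf] by simp
    also have "\<dots> = (\<lambda>i. Some (mix_h P i)) ` {1..mix_n P}"
      unfolding xs_def map_map comp_def fst_conv set_map set_upt atLeastLessThanSuc_atLeastAtMost ..
    also have "\<dots> \<subseteq> insert None (Some ` set_mset B)"
      using mem unfolding P_def by blast
    finally show ?thesis .
  next
    case True
    then show ?thesis by (simp add: MIX_R_def)
  qed
qed

end

(*
  The adversary's buffer is compared with the algorithm's by a min-cost matching (pot below) whose
  cost is an upper bound on what the adversary can still gain from being ahead.  Let w_0 = w_1 be
  the heaviest pending weight.  If the adversary transmits a packet whose partner is dominated by
  h_j, its gain plus the expected increase of the potential is at most w_j + sum_{i<j} p_i w_i,
  and p_i w_i <= w_i - w_{i+1} makes this telescope to at most w_0.  On the other hand the expected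
  gain of MIX-R is w_0 - (1 - p_n) w_n = w_0 (1 - prod_{i<=n} (1 - p_i)) >= w_0 (1 - 1/e),
  because the p_i sum to 1 and 1 - p <= exp (-p).
*)
theory Submission
  imports Defs
begin

section \<open>The potential\<close>

text \<open>
  \<open>cov \<phi> A B\<close>: the adversary's buffer \<open>B\<close> is no better than the algorithm's buffer \<open>A\<close> together
  with a credit of \<open>\<phi>\<close>.  A packet \<open>b\<close> of \<open>B\<close> is either paid for in full or matched with a
  packet of \<open>A\<close> that expires no earlier, in which case only the excess of its weight is paid.
\<close>

inductive cov :: "real \<Rightarrow> buffer \<Rightarrow> buffer \<Rightarrow> bool" where
  empty: "0 \<le> \<phi> \<Longrightarrow> cov \<phi> A {#}"
| unmatched: "cov \<phi> A B \<Longrightarrow> cov (\<phi> + weight b) A (add_mset b B)"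
| matched: "cov \<phi> A B \<Longrightarrow> deadline b \<le> deadline a \<Longrightarrow>
    cov (\<phi> + max 0 (weight b - weight a)) (add_mset a A) (add_mset b B)"

section \<open>Covers: slack, arrivals and removal of single packets\<close>

lemma cov_nonneg: "cov \<phi> A B \<Longrightarrow> legal_packets B \<Longrightarrow> 0 \<le> \<phi>"
  by (induction rule: cov.induct) (auto simp: legal_packets_def intro!: add_nonneg_nonneg)

text \<open>Slack in the credit is absorbed by the \<open>empty\<close> rule at the bottom of the
  derivation, and surplus packets of \<open>A'\<close> stay unmatched there.\<close>

lemma cov_mono: "cov \<phi> A B \<Longrightarrow> \<phi> \<le> \<psi> \<Longrightarrow> A \<subseteq># A' \<Longrightarrow> cov \<psi> A' B"
proof (induction arbitrary: \<psi> A' rule: cov.induct)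
  case (empty \<phi> A)
  then show ?case by (auto intro: cov.empty)
next
  case (unmatched \<phi> A B b)
  then show ?case using cov.unmatched[of "\<psi> - weight b" A' B b] by simp
next
  case (matched \<phi> A B b a)
  then obtain A'' where A'': "A' = add_mset a A''"
    by (metis insert_noteq_member mset_add mset_subset_eq_insertD)
  then have "A \<subseteq># A''" using matched.prems by simp
  then show ?case
    using cov.matched[of "\<psi> - max 0 (weight b - weight a)" A'' B b a] matched by (simp add: A'')
qed

text \<open>Each new arrival reaches both buffers and is matched with its own copy at no cost, so
  injections never raise the credit.\<close>

lemma cov_add_same: "cov \<phi> A B \<Longrightarrow> cov \<phi> (A + J) (B + J)"
  by (induction J) (auto dest: cov.matched[OF _ order_refl])

lemma cov_refl: "cov 0 J J"
  using cov_add_same[OF cov.empty[of 0 "{#}"], of J] by simp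

text \<open>The pairs of a cover can be listed in any order, so the rule that introduced
  \<open>z\<close> may be taken last and undone. Either \<open>z\<close> was paid in full, or its
  partner \<open>a\<close> leaves the cover with it; the cost is refunded.\<close>

lemma cov_remove_right:
  assumes "cov \<phi> A B" "z \<in># B"
  shows "cov (\<phi> - weight z) A (B - {#z#}) \<or>
    (\<exists>a A'. A = add_mset a A' \<and> deadline z \<le> deadline a \<and>
       cov (\<phi> - max 0 (weight z - weight a)) A' (B - {#z#}))"
  using assms
proof (induction rule: cov.induct)
  case (unmatched \<phi> A B b)
  show ?case
  proof (cases "z = b")
    case False
    then have z: "z \<in># B" using unmatched.prems by simp
    have eq: "add_mset b B - {#z#} = add_mset b (B - {#z#})" using False by simp
    from unmatched.IH[OF z] show ?thesis
    proof (elim disjE exE conjE)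
      assume "cov (\<phi> - weight z) A (B - {#z#})"
      from cov.unmatched[OF this, of b] show ?thesis unfolding eq by (simp add: algebra_simps)
    next
      fix a A' assume *: "A = add_mset a A'" "deadline z \<le> deadline a"
        "cov (\<phi> - max 0 (weight z - weight a)) A' (B - {#z#})"
      from cov.unmatched[OF *(3), of b] * show ?thesis unfolding eq by (auto simp: algebra_simps)
    qed
  qed (use unmatched in simp)
next
  case (matched \<phi> A B b c)
  show ?case
  proof (cases "z = b")
    case False
    then have z: "z \<in># B" using matched.prems by simp
    have eq: "add_mset b B - {#z#} = add_mset b (B - {#z#})" using False by simp
    from matched.IH[OF z] show ?thesis
    proof (elim disjE exE conjE)
      assume "cov (\<phi> - weight z) A (B - {#z#})"
      from cov.matched[OF this matched.hyps(2)] show ?thesis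
        unfolding eq by (simp add: algebra_simps)
    next
      fix a A' assume *: "A = add_mset a A'" "deadline z \<le> deadline a"
        "cov (\<phi> - max 0 (weight z - weight a)) A' (B - {#z#})"
      have "cov (\<phi> + max 0 (weight b - weight c) - max 0 (weight z - weight a))
          (add_mset c A') (add_mset b (B - {#z#}))"
        using cov.matched[OF *(3) matched.hyps(2)] by (simp add: algebra_simps)
      moreover have "add_mset c A = add_mset a (add_mset c A')" using * by simp
      ultimately show ?thesis unfolding eq using *(2) by blast
    qed
  next
    case True
    then have "cov (\<phi> + max 0 (weight b - weight c) - max 0 (weight z - weight c)) A
        (add_mset b B - {#z#})"
      using matched.hyps(1) by simp
    then show ?thesis using True matched.hyps(2) by blast
  qed
qed simp

text \<open>The counterpart on the algorithm's side: an unmatched \<open>f\<close> can be deleted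
  for free, a matched one leaves together with its partner \<open>b\<close>.\<close>

lemma cov_remove_left:
  assumes "cov \<phi> A B" "f \<in># A"
  shows "cov \<phi> (A - {#f#}) B \<or>
    (\<exists>b B'. B = add_mset b B' \<and> deadline b \<le> deadline f \<and>
       cov (\<phi> - max 0 (weight b - weight f)) (A - {#f#}) B')"
  using assms
proof (induction rule: cov.induct)
  case (empty \<phi> A)
  then show ?case by (auto intro: cov.empty)
next
  case (unmatched \<phi> A B c)
  from unmatched.IH[OF unmatched.prems] show ?case
  proof (elim disjE exE conjE)
    assume "cov \<phi> (A - {#f#}) B"
    from cov.unmatched[OF this, of c] show ?thesis by simp
  next
    fix b B' assume *: "B = add_mset b B'" "deadline b \<le> deadline f"
      "cov (\<phi> - max 0 (weight b - weight f)) (A - {#f#}) B'"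
    have "cov (\<phi> + weight c - max 0 (weight b - weight f)) (A - {#f#}) (add_mset c B')"
      using cov.unmatched[OF *(3), of c] by (simp add: algebra_simps)
    moreover have "add_mset c B = add_mset b (add_mset c B')" using * by simp
    ultimately show ?thesis using *(2) by blast
  qed
next
  case (matched \<phi> A B c a)
  show ?case
  proof (cases "f = a")
    case False
    then have f: "f \<in># A" using matched.prems by simp
    have eq: "add_mset a A - {#f#} = add_mset a (A - {#f#})" using False by simp
    from matched.IH[OF f] show ?thesis
    proof (elim disjE exE conjE)
      assume "cov \<phi> (A - {#f#}) B"
      from cov.matched[OF this matched.hyps(2)] show ?thesis unfolding eq by simp
    next
      fix b B' assume *: "B = add_mset b B'" "deadline b \<le> deadline f"
        "cov (\<phi> - max 0 (weight b - weight f)) (A - {#f#}) B'"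
      have "cov (\<phi> + max 0 (weight c - weight a) - max 0 (weight b - weight f))
          (add_mset a (A - {#f#})) (add_mset c B')"
        using cov.matched[OF *(3) matched.hyps(2)] by (simp add: algebra_simps)
      moreover have "add_mset c B = add_mset b (add_mset c B')" using * by simp
      ultimately show ?thesis unfolding eq using *(2) by blast
    qed
  next
    case True
    then have "cov (\<phi> + max 0 (weight c - weight a) - max 0 (weight c - weight f))
        (add_mset a A - {#f#}) B"
      using matched.hyps(1) by simp
    then show ?thesis using True matched.hyps(2) by blast
  qed
qed

section \<open>Covers under aging and under the algorithm's transmissions\<close>

lemma age_empty [simp]: "age {#} = {#}"
  and age_add_mset: "age (add_mset b B) =
    (if 1 < deadline b then add_mset (weight b, deadline b - 1) (age B) else age B)"
  by (auto simp: age_def case_prod_beta)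

text \<open>A partner expires no earlier than its packet, so a pair whose packet survives remains a
  pair. When a packet of \<open>B\<close> expires, its nonnegative cost only adds slack.\<close>

lemma cov_age: "cov \<phi> A B \<Longrightarrow> legal_packets B \<Longrightarrow> cov \<phi> (age A) (age B)"
proof (induction rule: cov.induct)
  case (empty \<phi> A)
  then show ?case by (auto intro: cov.empty)
next
  case (unmatched \<phi> A B b)
  then have IH: "cov \<phi> (age A) (age B)" and "0 < weight b" by (auto simp: legal_packets_def)
  then show ?case
    using cov.unmatched[OF IH, of "(weight b, deadline b - 1)"]
    by (auto simp: age_add_mset intro: cov_mono)
next
  case (matched \<phi> A B b a)
  then have IH: "cov \<phi> (age A) (age B)" by (auto simp: legal_packets_def)
  show ?case
  proof (cases "1 < deadline b")
    case True
    then show ?thesis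
      using cov.matched[OF IH, of "(weight b, deadline b - 1)" "(weight a, deadline a - 1)"]
        matched.hyps(2) by (auto simp: age_add_mset)
  next
    case False
    then show ?thesis using cov_mono[OF IH] by (auto simp: age_add_mset)
  qed
qed

text \<open>A packet \<open>b\<close> deprived of its partner is paid in full. The price rises by
  \<open>min (weight b) (weight f)\<close>, hence by at most \<open>weight f\<close>.\<close>

lemma cov_transmit_left:
  assumes "cov \<phi> A B" "f \<in># A" "0 < weight f"
  shows "cov (\<phi> + weight f) (A - {#f#}) B"
  using cov_remove_left[OF assms(1,2)]
proof (elim disjE exE conjE)
  assume "cov \<phi> (A - {#f#}) B"
  then show ?thesis using assms(3) by (auto intro: cov_mono)
next
  fix b B' assume *: "B = add_mset b B'" "cov (\<phi> - max 0 (weight b - weight f)) (A - {#f#}) B'"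
  from cov.unmatched[OF *(2), of b] show ?thesis unfolding *(1) by (rule cov_mono) auto
qed

text \<open>Here \<open>a\<close> is free, and a partner \<open>b\<close> of \<open>f\<close>
  expires no later than \<open>f\<close>, hence no later than \<open>a\<close>. The new price obeys
  the triangle inequality for \<open>max 0 (weight x - weight y)\<close>.\<close>

lemma cov_transmit_rematch:
  assumes "cov \<phi> A B" "f \<in># add_mset a A" "deadline f \<le> deadline a"
  shows "cov (\<phi> + max 0 (weight f - weight a)) (add_mset a A - {#f#}) B"
proof (cases "f = a")
  case True
  then show ?thesis using assms by simp
next
  case False
  then have f: "f \<in># A" and eq: "add_mset a A - {#f#} = add_mset a (A - {#f#})"
    using assms by simp_all
  from cov_remove_left[OF assms(1) f] show ?thesis unfolding eq
  proof (elim disjE exE conjE)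
    assume "cov \<phi> (A - {#f#}) B"
    then show "cov (\<phi> + max 0 (weight f - weight a)) (add_mset a (A - {#f#})) B"
      by (rule cov_mono) auto
  next
    fix b B' assume *: "B = add_mset b B'" "deadline b \<le> deadline f"
      "cov (\<phi> - max 0 (weight b - weight f)) (A - {#f#}) B'"
    have "deadline b \<le> deadline a" using *(2) assms(3) by simp
    from cov.matched[OF *(3) this]
    show "cov (\<phi> + max 0 (weight f - weight a)) (add_mset a (A - {#f#})) B"
      unfolding *(1) by (rule cov_mono) auto
  qed
qed


section \<open>The packets selected by MIX-R\<close>

context
  fixes P :: "packet set"
  assumes fin: "finite P" and ne: "P \<noteq> {}" and pos: "\<And>p. p \<in> P \<Longrightarrow> 0 < weight p"
begin

section \<open>Weights and deadlines along the chain of selected packets\<close>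

lemma mix_H_nonempty: "k < mix_m P \<Longrightarrow> mix_H P k \<noteq> {}"
  using not_less_Least unfolding mix_m_def by blast

lemma mix_h_in_mix_H: "k < mix_m P \<Longrightarrow> mix_h P (Suc k) \<in> mix_H P k"
  using mix_next_heaviest(1)[OF fin mix_H_nonempty] by (simp add: mix_h_def)

lemma mix_h_heaviest: "k < mix_m P \<Longrightarrow> y \<in> mix_H P k \<Longrightarrow> weight y \<le> weight (mix_h P (Suc k))"
  using mix_next_heaviest(2)[OF fin mix_H_nonempty] by (simp add: mix_h_def)

lemma mix_H_antimono: "i \<le> j \<Longrightarrow> mix_H P j \<subseteq> mix_H P i"
  by (induction j rule: dec_induct) auto

lemma mix_h_mem: "k \<le> mix_m P \<Longrightarrow> mix_h P k \<in> P"
  using arg_max_weight(1)[OF fin ne] mix_h_in_mix_H[of "k - 1"] mix_H_subset[of P "k - 1"]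
  by (cases k) (auto simp: mix_h_def)

lemma mix_h_weight_pos: "k \<le> mix_m P \<Longrightarrow> 0 < weight (mix_h P k)"
  by (intro pos mix_h_mem)

lemma mix_h_weight_antimono:
  assumes "i \<le> j" "j \<le> mix_m P"
  shows "weight (mix_h P j) \<le> weight (mix_h P i)"
proof (cases i)
  case 0
  then show ?thesis using arg_max_weight(2)[OF fin ne] mix_h_mem[OF assms(2)] by (simp add: mix_h_def)
next
  case (Suc k)
  with assms obtain l where l: "j = Suc l" by (cases j) auto
  show ?thesis
    using mix_h_heaviest[of k "mix_h P j"] mix_h_in_mix_H[of l] mix_H_antimono[of k l] assms Suc l
    by auto
qed

text \<open>\<open>mix_h P j\<close> is no heavier than \<open>mix_h P i\<close> and yet survived
  the filter by it, so it must expire earlier. Index 0 is excluded because \<open>mix_h P 0\<close>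
  filters nothing.\<close>

lemma mix_h_deadline_strict_antimono:
  assumes "1 \<le> i" "i < j" "j \<le> mix_m P"
  shows "deadline (mix_h P j) < deadline (mix_h P i)"
proof -
  obtain k l where kl: "i = Suc k" "j = Suc l" using assms by (cases i; cases j) auto
  have "mix_h P j \<in> mix_H P i"
    using mix_h_in_mix_H[of l] mix_H_antimono[of i l] assms kl by auto
  then have "\<not> dominated_by (mix_h P j) (mix_h P i)" by (simp add: kl(1) mix_h_def)
  then show ?thesis using mix_h_weight_antimono[of i j] assms by (simp add: dominated_by_def)
qed

text \<open>A packet leaves \<open>mix_H\<close> only by being dominated by the packet just
  selected, and the loop ends with the empty set.\<close>

lemma mix_h_dominates:
  assumes "a \<in> P"
  obtains j where "j \<in> {1..mix_m P}" "dominated_by a (mix_h P j)"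
proof -
  have "a \<in> mix_H P k \<or> (\<exists>j\<in>{1..k}. dominated_by a (mix_h P j))" for k
  proof (induction k)
    case (Suc k)
    show ?case
    proof (cases "dominated_by a (mix_h P (Suc k))")
      case True
      then show ?thesis by force
    next
      case False
      then show ?thesis using Suc by (force simp: mix_h_def[of P "Suc k"])
    qed
  qed (use assms in simp)
  moreover have "mix_H P (mix_m P) = {}"
    unfolding mix_m_def by (rule LeastI_ex[OF mix_H_terminates[OF fin]])
  ultimately show ?thesis using that by blast
qed

section \<open>Probabilities, expected gain and charges along the chain\<close>

lemma mix_frac_nonneg:
  "k < mix_m P \<Longrightarrow> 0 \<le> 1 - weight (mix_h P (Suc k)) / weight (mix_h P k)"
  using mix_h_weight_antimono[of k "Suc k"] mix_h_weight_pos[of k] by (simp add: divide_le_eq)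

text \<open>The remainder \<open>mix_r\<close> never increases, so the indices where it is positive
  form an initial segment; the cardinality \<open>mix_n P\<close> is therefore also the last such
  index.\<close>

lemma mix_n_eq: "{k \<in> {1..mix_m P}. mix_r P k > 0} = {1..mix_n P}"
proof -
  let ?A = "{k \<in> {1..mix_m P}. mix_r P k > 0}"
  have r_pos: "mix_r P i > 0" if "i \<le> k" "k \<le> mix_m P" "mix_r P k > 0" for i k
    using that
  proof (induction k rule: dec_induct)
    case (step k)
    then show ?case using mix_frac_nonneg[of k] by (auto simp: min_def split: if_splits)
  qed
  show ?thesis
  proof (cases "?A = {}")
    case True
    then show ?thesis unfolding mix_n_def by (simp only: card.empty) simp
  next
    case False
    then have M: "Max ?A \<in> ?A" by (intro Max_in) auto
    have "?A = {1..Max ?A}"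
    proof (intro equalityI subsetI)
      fix x assume "x \<in> {1..Max ?A}"
      then show "x \<in> ?A" using M r_pos[of x "Max ?A"] by auto
    qed auto
    then show ?thesis unfolding mix_n_def by (metis card_atLeastAtMost diff_Suc_1)
  qed
qed

lemma mix_n_le: "mix_n P \<le> mix_m P"
proof (cases "mix_n P")
  case (Suc k)
  then have "mix_n P \<in> {1..mix_n P}" by simp
  then show ?thesis unfolding mix_n_eq[symmetric] by simp
qed simp

lemma mix_p_props:
  shows mix_p_sum: "(\<Sum>i\<in>{1..mix_n P}. mix_p P i) = 1"
    and mix_p_nonneg: "i \<in> {1..mix_n P} \<Longrightarrow> 0 \<le> mix_p P i"
proof -
  have wf: "pmf_of_list_wf (map (\<lambda>i. (Some (mix_h P i), mix_p P i)) [1..<Suc (mix_n P)])"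
    by (rule mix_wf(1)[OF fin ne pos])
  show "i \<in> {1..mix_n P} \<Longrightarrow> 0 \<le> mix_p P i"
    using wf by (auto simp: pmf_of_list_wf_def simp del: upt_Suc)
  have "sum_list (map (mix_p P) [1..<Suc (mix_n P)]) = 1"
    using wf by (simp add: pmf_of_list_wf_def comp_def del: upt_Suc)
  moreover have "sum_list (map (mix_p P) [1..<Suc (mix_n P)]) = (\<Sum>i\<in>{1..mix_n P}. mix_p P i)"
    by (simp only: interv_sum_list_conv_sum_set_nat set_upt atLeastLessThanSuc_atLeastAtMost)
  ultimately show "(\<Sum>i\<in>{1..mix_n P}. mix_p P i) = 1" by simp
qed

lemma mix_p_weight_le:
  assumes "k < mix_m P"
  shows "mix_p P k * weight (mix_h P k) \<le> weight (mix_h P k) - weight (mix_h P (Suc k))"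
proof -
  have "mix_p P k \<le> 1 - weight (mix_h P (Suc k)) / weight (mix_h P k)"
    using assms by (simp add: mix_p_def)
  then have "mix_p P k * weight (mix_h P k) \<le>
      (1 - weight (mix_h P (Suc k)) / weight (mix_h P k)) * weight (mix_h P k)"
    using mix_h_weight_pos[of k] assms by (intro mult_right_mono) auto
  then show ?thesis using mix_h_weight_pos[of k] assms by (simp add: left_diff_distrib)
qed

lemma mix_prefix_weight_le:
  "j \<le> mix_m P \<Longrightarrow> (\<Sum>i<j. mix_p P i * weight (mix_h P i)) + weight (mix_h P j) \<le> weight (mix_h P 0)"
proof (induction j)
  case (Suc j)
  then show ?case using mix_p_weight_le[of j] by simp
qed simp

text \<open>Below \<open>mix_n P\<close> the minimum defining \<open>mix_p\<close> is never the
  remainder, since that would leave remainder 0. The probability is then exactly the relative weight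
  loss, so the telescoping bound becomes an equality and each step yields a factor
  \<open>1 - p \<le> exp (-p)\<close>.\<close>

lemma mix_prefix_eq:
  assumes "k \<le> mix_n P"
  shows "(\<Sum>i<k. mix_p P i * weight (mix_h P i)) = weight (mix_h P 0) - weight (mix_h P k) \<and>
    weight (mix_h P k) \<le> weight (mix_h P 0) * exp (- (\<Sum>i<k. mix_p P i))"
  using assms
proof (induction k)
  case (Suc k)
  let ?w = "\<lambda>i. weight (mix_h P i)"
  have IH: "(\<Sum>i<k. mix_p P i * ?w i) = ?w 0 - ?w k" "?w k \<le> ?w 0 * exp (- (\<Sum>i<k. mix_p P i))"
    using Suc by auto
  have k: "k < mix_m P" using Suc.prems mix_n_le by simp
  have "Suc k \<in> {1..mix_n P}" using Suc.prems by simp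
  then have "mix_r P (Suc k) > 0" unfolding mix_n_eq[symmetric] by blast
  then have p: "mix_p P k = 1 - ?w (Suc k) / ?w k"
    using k by (auto simp: mix_p_def min_def split: if_splits)
  have w: "?w (Suc k) = (1 - mix_p P k) * ?w k"
    using mix_h_weight_pos[of k] k by (simp add: p)
  have "1 - mix_p P k \<ge> 0" using k mix_h_weight_pos[of k] mix_h_weight_pos[of "Suc k"] by (simp add: p)
  then have "?w (Suc k) \<le> (1 - mix_p P k) * (?w 0 * exp (- (\<Sum>i<k. mix_p P i)))"
    unfolding w using IH by (intro mult_left_mono) auto
  also have "\<dots> \<le> exp (- mix_p P k) * (?w 0 * exp (- (\<Sum>i<k. mix_p P i)))"
    using exp_ge_add_one_self[of "- mix_p P k"] mix_h_weight_pos[of 0]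
    by (intro mult_right_mono) auto
  also have "\<dots> = ?w 0 * exp (- (\<Sum>i<Suc k. mix_p P i))"
    by (simp add: mult.left_commute mult_exp_exp)
  finally show ?case using IH w by (simp add: left_diff_distrib)
qed simp

text \<open>\<open>mix_p P 0\<close> vanishes, so telescoping sums from index 0 agree with
  expectations from index 1.\<close>

private lemma sum_atLeast1: "(\<Sum>i<k. mix_p P i * f i) = (\<Sum>i\<in>{1..<k}. mix_p P i * (f i :: real))"
proof (rule sum.mono_neutral_right)
  have p0: "mix_p P 0 = 0" by (rule mix_wf(3)[OF fin ne pos])
  show "\<forall>i\<in>{..<k} - {1..<k}. mix_p P i * f i = 0"
  proof
    fix i assume "i \<in> {..<k} - {1..<k}"
    then have "i = 0" by auto
    then show "mix_p P i * f i = 0" by (simp add: p0)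
  qed
qed auto

lemma mix_gain_ge:
  "(1 - exp (-1)) * weight (mix_h P 0) \<le> (\<Sum>i\<in>{1..mix_n P}. mix_p P i * weight (mix_h P i))"
proof -
  let ?n = "mix_n P" and ?w = "\<lambda>i. weight (mix_h P i)"
  have sum_p: "(\<Sum>i<Suc ?n. mix_p P i) = 1"
    using sum_atLeast1[of "\<lambda>_. 1" "Suc ?n"] mix_p_sum
    by (simp add: atLeastLessThanSuc_atLeastAtMost del: sum.lessThan_Suc)
  have "(\<Sum>i\<in>{1..?n}. mix_p P i) \<noteq> 0" using mix_p_sum by simp
  then have n: "?n \<in> {1..?n}" by (cases ?n) auto
  have p1: "mix_p P ?n \<le> 1"
    unfolding mix_p_sum[symmetric] by (rule member_le_sum[OF n]) (use mix_p_nonneg in blast)+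
  \<comment> \<open>The last probability is leftover mass and need not equal a relative weight loss;
    \<open>1 - p \<le> exp (-p)\<close> still supplies its factor, and the exponents sum to
    -1.\<close>
  have "(1 - mix_p P ?n) * ?w ?n \<le> exp (- mix_p P ?n) * (?w 0 * exp (- (\<Sum>i<?n. mix_p P i)))"
  proof (rule mult_mono)
    show "1 - mix_p P ?n \<le> exp (- mix_p P ?n)"
      using exp_ge_add_one_self[of "- mix_p P ?n"] by simp
    show "?w ?n \<le> ?w 0 * exp (- (\<Sum>i<?n. mix_p P i))" using mix_prefix_eq[of ?n] by simp
    show "0 \<le> ?w ?n" using mix_h_weight_pos[OF mix_n_le] by simp
  qed simp
  also have "\<dots> = ?w 0 * exp (- (\<Sum>i<Suc ?n. mix_p P i))"
    by (simp add: mult.left_commute mult_exp_exp)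
  also have "\<dots> = ?w 0 * exp (-1)" unfolding sum_p ..
  finally have "?w 0 - ?w 0 * exp (-1) \<le> (\<Sum>i<Suc ?n. mix_p P i * ?w i)"
    using conjunct1[OF mix_prefix_eq[of ?n]] by (simp add: left_diff_distrib)
  then show ?thesis
    unfolding sum_atLeast1 atLeastLessThanSuc_atLeastAtMost left_diff_distrib
    by (simp add: mult.commute)
qed

text \<open>Used when the partner of the adversary's packet is dominated by
  \<open>mix_h P j\<close>; the sum is the expected surcharge for transmitting a packet earlier in
  the chain.\<close>

lemma mix_charge_le:
  assumes "j \<le> mix_m P" "u \<le> weight (mix_h P j)"
  shows "u + (\<Sum>i\<in>{1..mix_n P}. mix_p P i * (if i < j then weight (mix_h P i) else 0)) \<le> weight (mix_h P 0)"
proof -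
  \<comment> \<open>The dominating index \<open>j\<close> may exceed \<open>mix_n P\<close>. The cap
    keeps exactly the indices that occur in the sum, and the weight does not drop when
    \<open>j\<close> is lowered to it.\<close>
  let ?j = "min j (Suc (mix_n P))" and ?w = "\<lambda>i. weight (mix_h P i)"
  have j: "?j \<le> mix_m P" using assms(1) by simp
  have "(\<Sum>i\<in>{1..mix_n P}. mix_p P i * (if i < j then ?w i else 0)) =
      (\<Sum>i\<in>{1..<?j}. mix_p P i * ?w i)"
    by (intro sum.mono_neutral_cong_right) auto
  also have "\<dots> = (\<Sum>i<?j. mix_p P i * ?w i)" by (rule sum_atLeast1[symmetric])
  also have "(\<Sum>i<?j. mix_p P i * ?w i) \<le> ?w 0 - ?w ?j"
    using mix_prefix_weight_le[OF j] by linarith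
  also have "\<dots> \<le> ?w 0 - u" using mix_h_weight_antimono[of ?j j] assms by auto
  finally show ?thesis by simp
qed

end


section \<open>One step of the game\<close>

definition val :: "packet option \<Rightarrow> real" where
  "val x = (case x of None \<Rightarrow> 0 | Some p \<Rightarrow> weight p)"

lemma legal_packets_send: "legal_packets B \<Longrightarrow> legal_packets (send x B)"
  by (auto simp: legal_packets_def send_def split: option.splits dest: in_diffD)

lemma legal_packets_age: "legal_packets B \<Longrightarrow> legal_packets (age B)"
  by (auto simp: legal_packets_def age_def)

lemma legal_packets_pending: "(\<And>t. legal_packets (J t)) \<Longrightarrow> legal_packets (pending J s t)"
proof (induction t)
  case (Suc t)
  then have "legal_packets (age (send (s t) (pending J s t)))" "legal_packets (J (Suc t))"
    by (auto intro: legal_packets_age legal_packets_send)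
  then show ?case by (auto simp: legal_packets_def)
qed simp

text \<open>
  If the adversary transmits a packet matched with \<open>a\<close>, and \<open>h\<^sub>j\<close> dominates \<open>a\<close>, then \<open>a\<close> becomes
  free.  When the algorithm transmits \<open>h\<^sub>i\<close> with \<open>i \<ge> j\<close>, the partner of \<open>h\<^sub>i\<close> can be matched with
  \<open>a\<close> instead; when \<open>i < j\<close>, it is paid for at the price of the weight of \<open>h\<^sub>i\<close>.
\<close>

lemma cov_step:
  assumes cov: "cov \<phi> A B" and A: "legal_packets A" "A \<noteq> {#}"
    and z: "\<And>b. z = Some b \<Longrightarrow> b \<in># B"
  defines "P \<equiv> set_mset A"
  obtains \<psi> where "\<And>i. i \<in> {1..mix_n P} \<Longrightarrow> cov (\<psi> i) (A - {#mix_h P i#}) (send z B)"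
    and "val z + (\<Sum>i\<in>{1..mix_n P}. mix_p P i * \<psi> i) \<le> \<phi> + weight (mix_h P 0)"
proof -
  note witness = that
  have fin: "finite P" and ne: "P \<noteq> {}" using A by (simp_all add: P_def)
  have pos: "0 < weight p" if "p \<in> P" for p
    using A(1) that unfolding legal_packets_def P_def by blast
  note mix = fin ne pos
  let ?n = "mix_n P" and ?h = "mix_h P" and ?p = "mix_p P"
  have hA: "?h i \<in># A" if "i \<le> mix_m P" for i using mix_h_mem[OF mix that] by (simp add: P_def)
  have sum_const: "(\<Sum>i\<in>{1..?n}. ?p i * (c + g i)) = c + (\<Sum>i\<in>{1..?n}. ?p i * g i)" for c g
    using mix_p_sum[OF mix] by (simp add: distrib_left sum.distrib sum_distrib_right[symmetric])
  have le_m: "i \<le> mix_m P" if "i \<in> {1..?n}" for i using that mix_n_le[OF mix] by simp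
  \<comment> \<open>No partner becomes free: the adversary's gain comes out of the credit, and the
    algorithm's packet is charged at its own weight, at most that of \<open>?h 0\<close>.\<close>
  have free: thesis if *: "cov (\<phi> - val z) A (send z B)"
  proof (rule witness)
    show "cov (\<phi> - val z + weight (?h i)) (A - {#?h i#}) (send z B)" if "i \<in> {1..?n}" for i
      using cov_transmit_left[OF * hA mix_h_weight_pos[OF mix]] le_m[OF that] by simp
    have "(\<Sum>i\<in>{1..?n}. ?p i * weight (?h i)) \<le> (\<Sum>i\<in>{1..?n}. ?p i * weight (?h 0))"
      using mix_h_weight_antimono[OF mix, of 0] mix_p_nonneg[OF mix] le_m
      by (intro sum_mono mult_left_mono) auto
    also have "\<dots> = weight (?h 0)" using mix_p_sum[OF mix] by (simp add: sum_distrib_right[symmetric])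
    finally show "val z + (\<Sum>i\<in>{1..?n}. ?p i * (\<phi> - val z + weight (?h i))) \<le> \<phi> + weight (?h 0)"
      unfolding sum_const by simp
  qed
  show thesis
  proof (cases z)
    case None
    then show thesis using cov free by (simp add: val_def send_def)
  next
    case (Some b)
    then have sz: "send z B = B - {#b#}" and vz: "val z = weight b" by (simp_all add: send_def val_def)
    from cov_remove_right[OF cov z[OF Some]] show thesis
    proof (elim disjE exE conjE)
      assume "cov (\<phi> - weight b) A (B - {#b#})"
      then show thesis by (intro free) (simp add: sz vz)
    next
      fix a A'
      assume A': "A = add_mset a A'" and "deadline b \<le> deadline a"
        and cov': "cov (\<phi> - max 0 (weight b - weight a)) A' (B - {#b#})"
      have "a \<in> P" by (simp add: P_def A')
      then obtain j where j: "j \<in> {1..mix_m P}" "dominated_by a (?h j)"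
        using mix_h_dominates[OF mix] by blast
      \<comment> \<open>The last summand bounds the rematching cost
        \<open>max 0 (weight (?h i) - weight a)\<close> for every \<open>i \<ge> j\<close> and is
        nonnegative by dominance. As \<open>min (weight b) (weight a) \<le> weight a\<close>, the
        sum \<open>weight b + c\<close> is at most \<open>\<phi> + weight (?h j)\<close>.\<close>
      define c where "c = \<phi> - max 0 (weight b - weight a) + (weight (?h j) - weight a)"
      let ?g = "\<lambda>i. if i < j then weight (?h i) else 0"
      show thesis
      proof (rule witness)
        fix i assume i: "i \<in> {1..?n}"
        have hi: "?h i \<in># add_mset a A'" using hA[OF le_m[OF i]] by (simp add: A')
        show "cov (c + ?g i) (A - {#?h i#}) (send z B)"
        proof (cases "i < j")
          case True
          have "cov (\<phi> - max 0 (weight b - weight a) + weight (?h i)) (A - {#?h i#}) (B - {#b#})"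
          \<comment> \<open>If \<open>A'\<close> holds no copy of \<open>?h i\<close>, then
            \<open>?h i\<close> is \<open>a\<close> itself, and transmitting it leaves the cover by
            \<open>A'\<close> intact.\<close>
          proof (cases "?h i \<in># A'")
            case True
            show ?thesis
              by (rule cov_mono[OF cov_transmit_left[OF cov' True mix_h_weight_pos[OF mix le_m[OF i]]]])
                (simp_all add: A' True)
          next
            case False
            then have "A - {#?h i#} = A'" using hi by (auto simp: A')
            then show ?thesis
              using cov_mono[OF cov'] mix_h_weight_pos[OF mix le_m[OF i]] by simp
          qed
          then show ?thesis
            unfolding sz by (rule cov_mono) (use True j(2) in \<open>auto simp: c_def dominated_by_def\<close>)
        next
          case False
          \<comment> \<open>From index \<open>j\<close> on, deadlines in the chain are at most that
            of \<open>?h j\<close>, which by dominance is at most that of \<open>a\<close>.\<close>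
          have "deadline (?h i) \<le> deadline (?h j)"
            using mix_h_deadline_strict_antimono[OF mix, of j i] False j le_m[OF i]
            by (cases "i = j") auto
          then have "deadline (?h i) \<le> deadline a" using j(2) by (simp add: dominated_by_def)
          moreover have "weight (?h i) \<le> weight (?h j)"
            using mix_h_weight_antimono[OF mix, of j i] False le_m[OF i] by simp
          ultimately show ?thesis
            using cov_mono[OF cov_transmit_rematch[OF cov' hi]] j(2) False
            by (simp add: sz A' c_def dominated_by_def)
        qed
      next
        have "weight (?h j) + (\<Sum>i\<in>{1..?n}. ?p i * ?g i) \<le> weight (?h 0)"
          using j by (intro mix_charge_le[OF mix]) auto
        then show "val z + (\<Sum>i\<in>{1..?n}. ?p i * (c + ?g i)) \<le> \<phi> + weight (?h 0)"
          unfolding sum_const vz c_def by linarith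
      qed
    qed
  qed
qed

section \<open>Expectations over one random choice\<close>

lemma nn_integral_pmf_of_list:
  assumes "pmf_of_list_wf xs"
  shows "(\<integral>\<^sup>+x. f x \<partial>pmf_of_list xs) = (\<Sum>(x, p)\<leftarrow>xs. f x * ennreal p)"
proof -
  \<comment> \<open>Equal keys pool their probabilities. A fixed finite superset \<open>S\<close> of
    the keys keeps the outer sum unchanged while the induction peels entries off the list.\<close>
  have "(\<Sum>x\<in>S. f x * ennreal (sum_list (map snd (filter (\<lambda>y. fst y = x) ys)))) =
      (\<Sum>(x, p)\<leftarrow>ys. f x * ennreal p)"
    if "finite S" "fst ` set ys \<subseteq> S" "\<And>y. y \<in> set ys \<Longrightarrow> 0 \<le> snd y" for S ys
    using that
  proof (induction ys)
    case (Cons y ys)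
    have "ennreal (sum_list (map snd (filter (\<lambda>y. fst y = x) (y # ys)))) =
        (if x = fst y then ennreal (snd y) else 0) + ennreal (sum_list (map snd (filter (\<lambda>y. fst y = x) ys)))" for x
    proof -
      have "0 \<le> snd y" using Cons.prems(3) by simp
      moreover have "0 \<le> sum_list (map snd (filter (\<lambda>y. fst y = x) ys))"
        using Cons.prems(3) by (intro sum_list_nonneg) fastforce
      ultimately show ?thesis by (cases "x = fst y") auto
    qed
    then show ?case using Cons
      by (simp add: distrib_left sum.distrib if_distrib[of "(*) _"] case_prod_beta cong: if_cong)
  qed simp
  note this[of "fst ` set xs" xs]
  moreover have "(\<integral>\<^sup>+x. f x \<partial>pmf_of_list xs) = (\<Sum>x\<in>fst ` set xs. f x * ennreal (pmf (pmf_of_list xs) x))"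
    using set_pmf_of_list[OF assms] by (intro nn_integral_measure_pmf_support) auto
  ultimately show ?thesis
    using assms unfolding pmf_pmf_of_list[OF assms] by (auto simp: pmf_of_list_wf_def)
qed

lemma nn_integral_MIX_R:
  assumes "legal_packets A" "A \<noteq> {#}"
  shows "(\<integral>\<^sup>+x. f x \<partial>MIX_R A) =
    (\<Sum>i\<in>{1..mix_n (set_mset A)}. f (Some (mix_h (set_mset A) i)) * ennreal (mix_p (set_mset A) i))"
proof -
  let ?P = "set_mset A"
  have "finite ?P" "?P \<noteq> {}" "\<And>p. p \<in> ?P \<Longrightarrow> 0 < weight p"
    using assms by (auto simp: legal_packets_def)
  then have wf: "pmf_of_list_wf (map (\<lambda>i. (Some (mix_h ?P i), mix_p ?P i)) [1..<Suc (mix_n ?P)])"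
    by (rule mix_wf(1))
  have "(\<integral>\<^sup>+x. f x \<partial>MIX_R A) =
      sum_list (map (\<lambda>i. f (Some (mix_h ?P i)) * ennreal (mix_p ?P i)) [1..<Suc (mix_n ?P)])"
    unfolding MIX_R_def Let_def if_not_P[OF assms(2)] nn_integral_pmf_of_list[OF wf]
    by (simp add: comp_def del: upt_Suc)
  then show ?thesis
    by (simp only: interv_sum_list_conv_sum_set_nat set_upt atLeastLessThanSuc_atLeastAtMost)
qed

section \<open>The potential and its change in one step\<close>

definition pot :: "buffer \<Rightarrow> buffer \<Rightarrow> ennreal" where
  "pot A B = (INF \<phi>\<in>{\<phi>. cov \<phi> A B}. ennreal \<phi>)"

lemma pot_le: "cov \<phi> A B \<Longrightarrow> pot A B \<le> ennreal \<phi>"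
  unfolding pot_def by (rule INF_lower) simp

lemma pot_refl: "pot J J = 0"
  using pot_le[OF cov_refl[of J]] by simp

lemma pot_age_add: "legal_packets B \<Longrightarrow> pot (age A + J) (age B + J) \<le> pot A B"
  unfolding pot_def[of A B] by (intro INF_greatest pot_le cov_add_same cov_age) auto

text \<open>A bound proved for every cover passes to the infimum once \<open>ennreal w\<close> is
  moved across by truncated subtraction, so no cheapest cover has to be exhibited.\<close>

lemma le_pot_add:
  assumes "\<And>\<phi>. cov \<phi> A B \<Longrightarrow> X \<le> ennreal \<phi> + ennreal w"
  shows "X \<le> pot A B + ennreal w"
proof -
  have "X - ennreal w \<le> pot A B"
    unfolding pot_def using assms by (intro INF_greatest) (auto simp: ennreal_minus_le_iff add.commute)
  then show ?thesis by (simp add: ennreal_minus_le_iff add.commute)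
qed

text \<open>The amortized inequality, arranged without subtraction because values lie in
  \<open>ennreal\<close>. \<open>cov_step\<close> bounds the bracket by \<open>pot A B\<close> plus
  w_0, and \<open>mix_gain_ge\<close> pays for \<open>c\<close> times w_0.\<close>

lemma pot_step:
  assumes A: "legal_packets A" and B: "legal_packets B" and z: "\<And>b. z = Some b \<Longrightarrow> b \<in># B"
  defines "c \<equiv> 1 - exp (-1) :: real"
  shows "ennreal c * (ennreal (val z) + (\<integral>\<^sup>+x. pot (send x A) (send z B) \<partial>MIX_R A))
    \<le> ennreal c * pot A B + (\<integral>\<^sup>+x. ennreal (val x) \<partial>MIX_R A)"
proof (cases "A = {#}")
  case True
  \<comment> \<open>The algorithm is idle, and no packet of \<open>B\<close> has a partner, so
    whatever the adversary sends was paid in full by the credit.\<close>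
  have "ennreal (val z) + pot {#} (send z B) \<le> pot {#} B + ennreal 0"
  proof (rule le_pot_add)
    fix \<phi> assume cov: "cov \<phi> {#} B"
    have cov': "cov (\<phi> - val z) {#} (send z B)"
      using cov_remove_right[OF cov z] cov by (cases z) (auto simp: val_def send_def)
    have "0 \<le> val z"
      using z B by (cases z) (auto simp: val_def legal_packets_def intro: less_imp_le)
    moreover have "0 \<le> \<phi> - val z" by (rule cov_nonneg[OF cov' legal_packets_send[OF B]])
    ultimately have "ennreal (val z) + ennreal (\<phi> - val z) = ennreal \<phi>"
      by (simp flip: ennreal_plus)
    then show "ennreal (val z) + pot {#} (send z B) \<le> ennreal \<phi> + ennreal 0"
      using add_left_mono[OF pot_le[OF cov'], of "ennreal (val z)"] by simp
  qed
  then show ?thesis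
    by (auto simp: True MIX_R_def send_def[of None] val_def[of None] intro: mult_left_mono)
next
  case False
  let ?P = "set_mset A"
  let ?n = "mix_n ?P" and ?h = "mix_h ?P" and ?p = "mix_p ?P"
  have mix: "finite ?P" "?P \<noteq> {}" "\<And>p. p \<in> ?P \<Longrightarrow> 0 < weight p"
    using A False by (auto simp: legal_packets_def)
  have c: "0 \<le> c" by (simp add: c_def)
  have w0: "0 < weight (?h 0)" by (rule mix_h_weight_pos[OF mix]) auto
  have val: "0 \<le> val z"
    using z B by (cases z) (auto simp: val_def legal_packets_def intro: less_imp_le)
  let ?E = "\<integral>\<^sup>+x. pot (send x A) (send z B) \<partial>MIX_R A"
  have "ennreal (val z) + ?E \<le> pot A B + ennreal (weight (?h 0))"
  proof (rule le_pot_add)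
    fix \<phi> assume cov: "cov \<phi> A B"
    obtain \<psi> where \<psi>: "\<And>i. i \<in> {1..?n} \<Longrightarrow> cov (\<psi> i) (A - {#?h i#}) (send z B)"
      "val z + (\<Sum>i\<in>{1..?n}. ?p i * \<psi> i) \<le> \<phi> + weight (?h 0)"
      using cov_step[OF cov A False z] by blast
    have nonneg: "0 \<le> ?p i * \<psi> i" if "i \<in> {1..?n}" for i
      using cov_nonneg[OF \<psi>(1)[OF that] legal_packets_send[OF B]] mix_p_nonneg[OF mix that] by simp
    have "?E = (\<Sum>i\<in>{1..?n}. pot (A - {#?h i#}) (send z B) * ennreal (?p i))"
      by (simp add: nn_integral_MIX_R[OF A False] send_def[of "Some _"])
    also have "\<dots> \<le> (\<Sum>i\<in>{1..?n}. ennreal (\<psi> i) * ennreal (?p i))"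
      using \<psi>(1) by (intro sum_mono mult_right_mono pot_le) auto
    also have "\<dots> = (\<Sum>i\<in>{1..?n}. ennreal (?p i * \<psi> i))"
      using mix_p_nonneg[OF mix] by (intro sum.cong) (auto simp: ennreal_mult'' mult.commute)
    also have "\<dots> = ennreal (\<Sum>i\<in>{1..?n}. ?p i * \<psi> i)" using nonneg by (rule sum_ennreal)
    finally have "ennreal (val z) + ?E \<le> ennreal (val z + (\<Sum>i\<in>{1..?n}. ?p i * \<psi> i))"
      using val sum_nonneg[of "{1..?n}" "\<lambda>i. ?p i * \<psi> i"] nonneg by (simp add: add_left_mono)
    also have "\<dots> \<le> ennreal (\<phi> + weight (?h 0))" by (rule ennreal_leI[OF \<psi>(2)])
    also have "\<dots> = ennreal \<phi> + ennreal (weight (?h 0))"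
      using cov_nonneg[OF cov B] w0 by simp
    finally show "ennreal (val z) + ?E \<le> ennreal \<phi> + ennreal (weight (?h 0))" .
  qed
  then have "ennreal c * (ennreal (val z) + ?E) \<le> ennreal c * (pot A B + ennreal (weight (?h 0)))"
    by (rule mult_left_mono) simp
  also have "\<dots> = ennreal c * pot A B + ennreal (c * weight (?h 0))"
    using c by (simp add: distrib_left ennreal_mult')
  also have "ennreal (c * weight (?h 0)) \<le> ennreal (\<Sum>i\<in>{1..?n}. ?p i * weight (?h i))"
    unfolding c_def by (rule ennreal_leI[OF mix_gain_ge[OF mix]])
  also have "\<dots> = (\<Sum>i\<in>{1..?n}. ennreal (?p i * weight (?h i)))"
  proof (intro sum_ennreal[symmetric] mult_nonneg_nonneg)
    fix i assume i: "i \<in> {1..?n}"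
    then show "0 \<le> ?p i" using mix_p_nonneg[OF mix, of i] by simp
    show "0 \<le> weight (?h i)" using mix_h_weight_pos[OF mix, of i] mix_n_le[OF mix] i by simp
  qed
  also have "\<dots> = (\<integral>\<^sup>+x. ennreal (val x) \<partial>MIX_R A)"
    unfolding nn_integral_MIX_R[OF A False] using mix_p_nonneg[OF mix]
    by (intro sum.cong) (auto simp: val_def ennreal_mult' mult.commute)
  finally show ?thesis by (simp add: add_left_mono)
qed


section \<open>The whole run\<close>

text \<open>Depends on a finite list only, so that expectations over runs reduce to integrals
  against a discrete law of histories.\<close>

definition buffer_after :: "injector \<Rightarrow> packet option list \<Rightarrow> buffer" where
  "buffer_after release h = pending (\<lambda>i. release (take i h)) (\<lambda>i. h ! i) (length h)"

definition adv_buffer_after :: "injector \<Rightarrow> answerer \<Rightarrow> packet option list \<Rightarrow> buffer" where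
  "adv_buffer_after release adv h =
     pending (\<lambda>i. release (take i h)) (\<lambda>i. adv (take i h)) (length h)"

lemma length_hist [simp]: "length (hist \<omega> t) = t"
  by (simp add: hist_def)

lemma hist_nth: "hist ((!) h) (length h) = h"
  by (simp add: hist_def map_nth)

lemma buffer_after_hist: "buffer_after release (hist \<omega> t) = pending (instance_of release \<omega>) \<omega> t"
  unfolding buffer_after_def length_hist
  by (rule pending_cong) (auto simp: instance_of_def take_hist, simp add: hist_def)

lemma adv_buffer_after_hist:
  "adv_buffer_after release adv (hist \<omega> t) = pending (instance_of release \<omega>) (answers_of adv \<omega>) t"
  unfolding adv_buffer_after_def length_hist
  by (rule pending_cong) (auto simp: instance_of_def answers_of_def take_hist)

lemma buffer_after_snoc:
  "buffer_after release (h @ [x]) = age (send x (buffer_after release h)) + release (h @ [x])"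
proof -
  have "pending (\<lambda>i. release (take i (h @ [x]))) (\<lambda>i. (h @ [x]) ! i) (length h) = buffer_after release h"
    unfolding buffer_after_def by (rule pending_cong) (auto simp: nth_append)
  then show ?thesis by (simp add: buffer_after_def)
qed

lemma adv_buffer_after_snoc:
  "adv_buffer_after release adv (h @ [x]) =
     age (send (adv h) (adv_buffer_after release adv h)) + release (h @ [x])"
proof -
  have "pending (\<lambda>i. release (take i (h @ [x]))) (\<lambda>i. adv (take i (h @ [x]))) (length h) =
      adv_buffer_after release adv h"
    unfolding adv_buffer_after_def by (rule pending_cong) auto
  then show ?thesis by (simp add: adv_buffer_after_def)
qed

section \<open>The discrete law of finite histories\<close>

primrec hist_pmf :: "algorithm \<Rightarrow> injector \<Rightarrow> nat \<Rightarrow> packet option list pmf" where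
  "hist_pmf alg release 0 = return_pmf []"
| "hist_pmf alg release (Suc t) = bind_pmf (hist_pmf alg release t)
     (\<lambda>h. map_pmf (\<lambda>x. h @ [x]) (alg (buffer_after release h)))"

lemma length_hist_pmf: "h \<in> set_pmf (hist_pmf alg release t) \<Longrightarrow> length h = t"
  by (induction t arbitrary: h) auto

text \<open>A list \<open>h @ [x]\<close> determines \<open>h\<close>, so only one component of the
  mixture contributes.\<close>

lemma pmf_hist_pmf_snoc:
  "pmf (hist_pmf alg release (Suc t)) (h @ [x]) =
     pmf (hist_pmf alg release t) h * pmf (alg (buffer_after release h)) x"
proof -
  let ?q = "\<lambda>h. alg (buffer_after release h)"
  have "pmf (map_pmf (\<lambda>x. h' @ [x]) (?q h')) (h @ [x]) = pmf (?q h) x * indicator {h} h'" for h'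
  proof (cases "h' = h")
    case True
    have "inj (\<lambda>x. h @ [x])" by (auto simp: inj_def)
    from pmf_map_inj'[OF this] show ?thesis by (simp add: True)
  next
    case False
    then have "h @ [x] \<notin> set_pmf (map_pmf (\<lambda>x. h' @ [x]) (?q h'))" by auto
    then show ?thesis using False by (simp add: pmf_eq_0_set_pmf)
  qed
  then have "ennreal (pmf (hist_pmf alg release (Suc t)) (h @ [x])) =
      (\<integral>\<^sup>+h'. ennreal (pmf (?q h) x) * indicator {h} h' \<partial>hist_pmf alg release t)"
    by (simp add: ennreal_pmf_bind ennreal_mult' ennreal_indicator)
  also have "\<dots> = ennreal (pmf (hist_pmf alg release t) h * pmf (?q h) x)"
    by (subst nn_integral_cmult_indicator) (simp_all add: emeasure_pmf_single ennreal_mult' mult.commute)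
  finally show ?thesis by (simp add: ennreal_inj)
qed

text \<open>The recursion in \<open>run_law\<close> fixes the mass of each single history, and
  \<open>hist_pmf\<close> obeys the same recursion. The masses on its countable support already add
  up to 1, so nothing remains outside.\<close>

lemma distr_hist:
  assumes "run_law alg release M"
  shows "distr M (count_space UNIV) (\<lambda>\<omega>. hist \<omega> t) = measure_pmf (hist_pmf alg release t)"
proof -
  from assms interpret prob_space M by (simp add: run_law_def)
  have sp: "space M = UNIV"
    and hm [measurable]: "\<And>t. (\<lambda>\<omega>. hist \<omega> t) \<in> measurable M (count_space UNIV)"
    and step: "\<And>\<omega> t. measure M {\<omega>'. hist \<omega>' (Suc t) = hist \<omega> (Suc t)} =
        measure M {\<omega>'. hist \<omega>' t = hist \<omega> t} * pmf (alg (buffer_after release (hist \<omega> t))) (\<omega> t)"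
    using assms by (simp_all add: run_law_def buffer_after_hist)
  let ?D = "distr M (count_space UNIV) (\<lambda>\<omega>. hist \<omega> t)" and ?\<Omega> = "set_pmf (hist_pmf alg release t)"
  have cyl: "measure M {\<omega>'. hist \<omega>' t = hist \<omega> t} = pmf (hist_pmf alg release t) (hist \<omega> t)" for \<omega> t
  proof (induction t)
    case 0
    then show ?case using prob_space by (simp add: hist_def sp)
  next
    case (Suc t)
    have "hist \<omega> (Suc t) = hist \<omega> t @ [\<omega> t]" by (simp add: hist_def)
    then show ?case unfolding step Suc by (simp only: pmf_hist_pmf_snoc)
  qed
  have eq: "emeasure ?D {h} = emeasure (measure_pmf (hist_pmf alg release t)) {h}" if "h \<in> ?\<Omega>" for h
  proof -
    \<comment> \<open>\<open>(!) h\<close> serves as a run extending \<open>h\<close>; its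
      unspecified values from position \<open>t\<close> on do not enter.\<close>
    have h: "hist ((!) h) t = h" using length_hist_pmf[OF that] hist_nth by metis
    have "emeasure ?D {h} = emeasure M {\<omega>'. hist \<omega>' t = h}"
      by (subst emeasure_distr) (auto simp: sp intro!: arg_cong[of _ _ "emeasure M"])
    then show ?thesis
      using cyl[of t "(!) h"] by (simp add: h emeasure_eq_measure emeasure_pmf_single)
  qed
  have "emeasure ?D ?\<Omega> = (\<integral>\<^sup>+h. emeasure ?D {h} \<partial>count_space ?\<Omega>)"
    by (rule emeasure_countable_singleton) auto
  also have "\<dots> = (\<integral>\<^sup>+h. emeasure (measure_pmf (hist_pmf alg release t)) {h} \<partial>count_space ?\<Omega>)"
    by (rule nn_integral_cong) (use eq in simp)
  also have "\<dots> = emeasure (measure_pmf (hist_pmf alg release t)) ?\<Omega>"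
    by (rule emeasure_countable_singleton[symmetric]) auto
  also have "\<dots> = 1" by (simp add: measure_pmf.emeasure_eq_1_AE AE_measure_pmf)
  finally have one: "emeasure ?D ?\<Omega> = 1" .
  interpret D: prob_space ?D by (rule prob_space_distr) simp
  show ?thesis
  proof (rule measure_eqI_countable_AE[where \<Omega> = ?\<Omega>])
    show "AE h in ?D. h \<in> ?\<Omega>"
      using one by (subst D.AE_in_set_eq_1) (simp_all add: D.emeasure_eq_measure)
  qed (use eq in \<open>auto simp: AE_measure_pmf\<close>)
qed

lemma nn_integral_hist:
  assumes "run_law alg release M"
  shows "(\<integral>\<^sup>+\<omega>. F (hist \<omega> t) \<partial>M) = (\<integral>\<^sup>+h. F h \<partial>hist_pmf alg release t)"
  using assms unfolding distr_hist[OF assms, symmetric]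
  by (subst nn_integral_distr) (auto simp: run_law_def)

lemma measurable_hist:
  assumes "run_law alg release M"
  shows "(\<lambda>\<omega>. F (hist \<omega> t) :: ennreal) \<in> borel_measurable M"
proof -
  have "(\<lambda>\<omega>. hist \<omega> t) \<in> measurable M (count_space UNIV)" using assms by (simp add: run_law_def)
  from measurable_compose[OF this, of F borel] show ?thesis by simp
qed

section \<open>Summation over the steps\<close>

text \<open>The expected potential on the left makes the induction close: \<open>pot_step\<close>,
  averaged over histories of length \<open>T\<close>, trades it for its successor. It starts at 0
  because both buffers then hold the same injection.\<close>

lemma prefix_gain_le:
  assumes adv: "adversary release adv"
  defines "c \<equiv> 1 - exp (-1) :: real" and "Q \<equiv> hist_pmf MIX_R release"
  shows "ennreal c * ((\<Sum>t<T. \<integral>\<^sup>+h. ennreal (val (adv h)) \<partial>Q t) +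
        (\<integral>\<^sup>+h. pot (buffer_after release h) (adv_buffer_after release adv h) \<partial>Q T))
    \<le> (\<Sum>t<T. \<integral>\<^sup>+h. ennreal (val (last h)) \<partial>Q (Suc t))"
proof (induction T)
  case 0
  have "pot (buffer_after release []) (adv_buffer_after release adv []) = 0"
    by (simp add: buffer_after_def adv_buffer_after_def pot_refl)
  then show ?case by (simp add: Q_def)
next
  case (Suc T)
  let ?A = "buffer_after release" and ?B = "adv_buffer_after release adv"
  let ?V = "\<lambda>t. \<integral>\<^sup>+h. ennreal (val (adv h)) \<partial>Q t"
  have legal: "legal_packets (?A h)" "legal_packets (?B h)" for h
    using adv unfolding buffer_after_def adv_buffer_after_def adversary_def
    by (auto intro!: legal_packets_pending)
  \<comment> \<open>\<open>adversary\<close> speaks of whole runs; \<open>(!) h\<close> extends the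
    history \<open>h\<close> to one.\<close>
  have pend: "b \<in># ?B h" if "adv h = Some b" for h b
  proof -
    have "answers_of adv ((!) h) (length h) = Some b" using that by (simp add: answers_of_def hist_nth)
    then have "b \<in># pending (instance_of release ((!) h)) (answers_of adv ((!) h)) (length h)"
      using adv unfolding adversary_def by blast
    then show ?thesis by (simp add: adv_buffer_after_hist[symmetric] hist_nth)
  qed
  have Q_Suc: "(\<integral>\<^sup>+h. F h \<partial>Q (Suc T)) = (\<integral>\<^sup>+h. (\<integral>\<^sup>+x. F (h @ [x]) \<partial>MIX_R (?A h)) \<partial>Q T)" for F
    by (simp add: Q_def)
  have "(\<integral>\<^sup>+h. pot (?A h) (?B h) \<partial>Q (Suc T))
      \<le> (\<integral>\<^sup>+h. (\<integral>\<^sup>+x. pot (send x (?A h)) (send (adv h) (?B h)) \<partial>MIX_R (?A h)) \<partial>Q T)"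
    unfolding Q_Suc buffer_after_snoc adv_buffer_after_snoc
    by (intro nn_integral_mono pot_age_add legal_packets_send legal)
  then have "ennreal c * (?V T + (\<integral>\<^sup>+h. pot (?A h) (?B h) \<partial>Q (Suc T)))
      \<le> ennreal c * (?V T +
        (\<integral>\<^sup>+h. (\<integral>\<^sup>+x. pot (send x (?A h)) (send (adv h) (?B h)) \<partial>MIX_R (?A h)) \<partial>Q T))"
    by (intro mult_left_mono add_left_mono) auto
  also have "\<dots> = (\<integral>\<^sup>+h. ennreal c * (ennreal (val (adv h)) +
        (\<integral>\<^sup>+x. pot (send x (?A h)) (send (adv h) (?B h)) \<partial>MIX_R (?A h))) \<partial>Q T)"
    by (simp add: nn_integral_cmult nn_integral_add)
  also have "\<dots> \<le> (\<integral>\<^sup>+h. ennreal c * pot (?A h) (?B h) +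
        (\<integral>\<^sup>+x. ennreal (val x) \<partial>MIX_R (?A h)) \<partial>Q T)"
    unfolding c_def by (intro nn_integral_mono pot_step legal pend)
  also have "\<dots> = ennreal c * (\<integral>\<^sup>+h. pot (?A h) (?B h) \<partial>Q T) + (\<integral>\<^sup>+h. ennreal (val (last h)) \<partial>Q (Suc T))"
    by (simp add: nn_integral_cmult nn_integral_add Q_Suc)
  finally have "ennreal c * ((\<Sum>t<T. ?V t) + ?V T + (\<integral>\<^sup>+h. pot (?A h) (?B h) \<partial>Q (Suc T)))
      \<le> ennreal c * ((\<Sum>t<T. ?V t) + (\<integral>\<^sup>+h. pot (?A h) (?B h) \<partial>Q T)) +
        (\<integral>\<^sup>+h. ennreal (val (last h)) \<partial>Q (Suc T))"
    by (simp add: distrib_left add.assoc add_left_mono)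
  then show ?case using Suc.IH by (auto intro: order_trans add_right_mono)
qed

theorem mainTheorem2:
  shows "competitive (exp 1 / (exp 1 - 1)) MIX_R"
  unfolding competitive_def
proof (intro conjI allI impI)
  show "transmits_pending MIX_R" by (rule MIX_R_transmits_pending)
next
  fix release adv M
  assume adv: "adversary release adv" and M: "run_law MIX_R release M"
  let ?c = "1 - exp (-1) :: real"
  have gain: "gain s = (\<Sum>t. ennreal (val (s t)))" for s
    unfolding gain_def by (intro suminf_cong) (simp add: val_def split: option.split)
  \<comment> \<open>The transmission of step \<open>t\<close> ends the history of length
    \<open>Suc t\<close>, while the adversary's answer in step \<open>t\<close> sees only the
    history of length \<open>t\<close>.\<close>
  have last_hist: "val (\<omega> t) = val (last (hist \<omega> (Suc t)))" for \<omega> t by (simp add: hist_def)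
  have R: "1 / (exp 1 / (exp 1 - 1)) = ?c"
    by (simp add: exp_minus field_simps)
  have alg: "(\<integral>\<^sup>+\<omega>. gain \<omega> \<partial>M) = (\<Sum>t. \<integral>\<^sup>+h. ennreal (val (last h)) \<partial>hist_pmf MIX_R release (Suc t))"
    unfolding gain last_hist
    by (subst nn_integral_suminf)
      (rule measurable_hist[OF M, of "\<lambda>h. ennreal (val (last h))"],
       simp only: nn_integral_hist[OF M, of "\<lambda>h. ennreal (val (last h))"])
  have ans: "(\<integral>\<^sup>+\<omega>. gain (answers_of adv \<omega>) \<partial>M) = (\<Sum>t. \<integral>\<^sup>+h. ennreal (val (adv h)) \<partial>hist_pmf MIX_R release t)"
    unfolding gain answers_of_def
    by (subst nn_integral_suminf)
      (rule measurable_hist[OF M, of "\<lambda>h. ennreal (val (adv h))"],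
       simp only: nn_integral_hist[OF M, of "\<lambda>h. ennreal (val (adv h))"])
  have "(\<Sum>t. ennreal ?c * (\<integral>\<^sup>+h. ennreal (val (adv h)) \<partial>hist_pmf MIX_R release t))
      \<le> (\<Sum>t. \<integral>\<^sup>+h. ennreal (val (last h)) \<partial>hist_pmf MIX_R release (Suc t))"
  \<comment> \<open>Partial sums suffice, even for infinite totals; each is bounded by
    \<open>prefix_gain_le\<close> after its nonnegative potential term is dropped.\<close>
  proof (rule suminf_le_const[OF summableI])
    fix T
    have "(\<Sum>t<T. ennreal ?c * (\<integral>\<^sup>+h. ennreal (val (adv h)) \<partial>hist_pmf MIX_R release t))
        \<le> (\<Sum>t<T. \<integral>\<^sup>+h. ennreal (val (last h)) \<partial>hist_pmf MIX_R release (Suc t))"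
      unfolding sum_distrib_left[symmetric]
      by (rule order_trans[OF mult_left_mono prefix_gain_le[OF adv]]) auto
    also have "\<dots> \<le> (\<Sum>t. \<integral>\<^sup>+h. ennreal (val (last h)) \<partial>hist_pmf MIX_R release (Suc t))"
      by (rule sum_le_suminf[OF summableI]) auto
    finally show "(\<Sum>t<T. ennreal ?c * (\<integral>\<^sup>+h. ennreal (val (adv h)) \<partial>hist_pmf MIX_R release t))
      \<le> (\<Sum>t. \<integral>\<^sup>+h. ennreal (val (last h)) \<partial>hist_pmf MIX_R release (Suc t))" .
  qed
  then show "ennreal (1 / (exp 1 / (exp 1 - 1))) * (\<integral>\<^sup>+\<omega>. gain (answers_of adv \<omega>) \<partial>M)
      \<le> (\<integral>\<^sup>+\<omega>. gain \<omega> \<partial>M)"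
    unfolding alg ans R by simp
qed

end
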